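(* A real number $q>1$ belongs to $\overline{\mathcal U}$ if and only if $1$ has a unique infinite expansion in base $q$.
   Context: For a real $q>1$, an expansion of a real number $x$ in base $q$ is a sequence $(c_i)_{i\ge1}$ of integers with $0\le c_i<q$ for all $i\ge1$ and $x=\sum_{i\ge1}c_iq^{-i}$. A sequence is called infinite if it contains infinitely many nonzero elements. $\mathcal U$ is the set of real numbers $q>1$ for which $1$ has exactly one expansion in base $q$, and $\overline{\mathcal U}$ is its topological closure. *)

theory Defs
  imports "HOL-Analysis.Analysis"
begin

text \<open>Digit sequences are indexed from 0: the entry \<open>c i\<close> is the digit \<open>c\<^sub>i\<^sub>+\<^sub>1\<close>,
  with weight \<open>q\<close> to the power \<open>-(i + 1)\<close>.\<close>

definition expansion :: "real \<Rightarrow> real \<Rightarrow> (nat \<Rightarrow> int) \<Rightarrow> bool" where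
  "expansion q x c \<longleftrightarrow>
     (\<forall>i. 0 \<le> c i \<and> real_of_int (c i) < q) \<and>
     (\<lambda>i. real_of_int (c i) / q ^ Suc i) sums x"

definition infinite_seq :: "(nat \<Rightarrow> int) \<Rightarrow> bool" where
  "infinite_seq c \<longleftrightarrow> infinite {i. c i \<noteq> 0}"

definition univoque_bases :: "real set" where
  "univoque_bases = {q. q > 1 \<and> (\<exists>!c. expansion q 1 c)}"

end

theory Submission
  imports Defs
begin

text \<open>Let \<open>M\<close> be the largest integer below \<open>q\<close>, so that the admissible digits are
  \<open>0, \<dots>, M\<close>. A real number has an expansion exactly when it lies between \<open>0\<close> and \<open>M / (q - 1)\<close>,
  and every positive number in this range has an infinite one. Replacing each digit \<open>k\<close> by
  \<open>M - k\<close> (reflection) turns expansions of \<open>x\<close> into expansions of \<open>M / (q - 1) - x\<close>.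
  In the integer base \<open>q = M + 1\<close> the number \<open>1\<close> is the largest one with an expansion, so this
  expansion is unique; below, \<open>q < M + 1\<close>.

  Suppose that \<open>1\<close> has two infinite expansions \<open>c\<close>, \<open>d\<close> which first differ at \<open>n\<close>, with
  \<open>d n < c n\<close>. Let \<open>T q'\<close> be what remains to be expanded, in base \<open>q'\<close>, after the digits
  \<open>d 0, \<dots>, d n\<close> of an expansion of \<open>1\<close>. Since \<open>c\<close> is infinite, \<open>T q > 1\<close>. If
  \<open>1 < T q' \<le> M / (q' - 1)\<close>, then both \<open>d n\<close> and \<open>d n + 1\<close> can be continued to an expansion of
  \<open>1\<close>, and \<open>q'\<close> is not univoque. If \<open>T q'\<close> exceeds the upper bound by a small \<open>\<delta>\<close>, then only
  \<open>d n + 1\<close> can be continued, and the reflection of what remains to be expanded is \<open>1 - \<delta>\<close>. Applying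
  the same digits to \<open>1 - \<delta>\<close> leaves a number slightly below \<open>M / (q' - 1)\<close>, so \<open>1 - \<delta>\<close>, and
  hence \<open>1\<close>, has two expansions. Both cases are settled by \<open>not_univoque_of_remainder\<close>, whose
  hypotheses are open conditions on the base; thus \<open>q\<close> has a neighbourhood without univoque bases
  (\<open>closure_imp_unique_infinite\<close>).

  Conversely, let \<open>a\<close> be the only infinite expansion of \<open>1\<close>. Uniqueness bounds the values of all
  tails of \<open>a\<close> and of their reflections (\<open>unique_infinite_tails\<close>), and this says that every tail
  of \<open>a\<close> is lexicographically at most \<open>a\<close> and every reflected tail is strictly below \<open>a\<close>
  (\<open>lex_of_tails\<close>). There are arbitrarily long prefixes \<open>p\<close> of \<open>a\<close> for which the strict
  inequalities are already visible inside \<open>p\<close> (\<open>strict_prefix_exists\<close>). Writing \<open>p'\<close> for the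
  reflection of \<open>p\<close> and \<open>p'\<^sup>+\<close> for \<open>p'\<close> with last digit increased by one, the sequence
  \<open>p p'\<^sup>+ p' p p' p \<dots>\<close> is strictly above all its proper tails and all its reflected tails.
  Such a sequence is the only expansion of \<open>1\<close> in any base in which it is one
  (\<open>univoque_of_lex\<close>), and by the intermediate value theorem it is one in a base
  close to \<open>q\<close>, because it shares a long prefix with \<open>a\<close>.\<close>

section \<open>Values of digit sequences\<close>

text \<open>Sequences over the alphabet \<open>{0..M}\<close>.\<close>

definition digits :: "int \<Rightarrow> (nat \<Rightarrow> int) \<Rightarrow> bool" where
  "digits M x \<longleftrightarrow> (\<forall>i. 0 \<le> x i \<and> x i \<le> M)"

text \<open>The number that a digit sequence represents in base \<open>q\<close>.\<close>

definition digit_value :: "real \<Rightarrow> (nat \<Rightarrow> int) \<Rightarrow> real" where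
  "digit_value q x = (\<Sum>i. real_of_int (x i) / q ^ Suc i)"

text \<open>\<open>M\<close> is the largest digit in base \<open>q\<close>, that is, the largest integer strictly below \<open>q\<close>; the
  condition \<open>1 \<le> M\<close> amounts to \<open>q > 1\<close>. As a relation rather than a function of \<open>q\<close>, it lets one
  alphabet serve several bases.\<close>

definition max_digit :: "real \<Rightarrow> int \<Rightarrow> bool" where
  "max_digit q M \<longleftrightarrow> 1 \<le> M \<and> real_of_int M < q \<and> q \<le> real_of_int M + 1"

text \<open>The tail of a sequence that remains after \<open>n\<close> digits are dropped.\<close>

definition shift :: "nat \<Rightarrow> (nat \<Rightarrow> int) \<Rightarrow> nat \<Rightarrow> int" where
  "shift n x = (\<lambda>i. x (n + i))"

text \<open>Digitwise reflection of the alphabet \<open>{0..M}\<close>.\<close>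

definition reflect :: "int \<Rightarrow> (nat \<Rightarrow> int) \<Rightarrow> nat \<Rightarrow> int" where
  "reflect M x = (\<lambda>i. M - x i)"

text \<open>The first \<open>n\<close> digits of \<open>d\<close>, followed by all of \<open>e\<close>.\<close>

definition splice_at :: "nat \<Rightarrow> (nat \<Rightarrow> int) \<Rightarrow> (nat \<Rightarrow> int) \<Rightarrow> nat \<Rightarrow> int" where
  "splice_at n d e = (\<lambda>i. if i < n then d i else e (i - n))"

lemma max_digit_gt_1: "max_digit q M \<Longrightarrow> 1 < q"
  by (auto simp: max_digit_def)

lemma max_digit_exists:
  assumes "1 < q"
  obtains M where "max_digit q M"
proof
  show "max_digit q (\<lceil>q\<rceil> - 1)"
    using assms unfolding max_digit_def by (auto; linarith)
qed

lemma max_digit_quotient_ge_1: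
  assumes "max_digit q M"
  shows "1 \<le> real_of_int M / (q - 1)"
  using assms by (simp add: max_digit_def field_simps)

lemma shift_apply [simp]: "shift n x i = x (n + i)"
  by (simp add: shift_def)

lemma reflect_apply [simp]: "reflect M x i = M - x i"
  by (simp add: reflect_def)

lemma shift_0 [simp]: "shift 0 x = x"
  by (simp add: shift_def)

lemma shift_shift [simp]: "shift m (shift n x) = shift (n + m) x"
  by (simp add: shift_def add.assoc)

lemma shift_reflect: "shift n (reflect M x) = reflect M (shift n x)"
  by (simp add: shift_def reflect_def)

lemma reflect_reflect [simp]: "reflect M (reflect M x) = x"
  by (simp add: reflect_def)

lemma shift_splice_at [simp]: "shift n (splice_at n d e) = e"
  by (simp add: shift_def splice_at_def)

lemma digits_shift: "digits M x \<Longrightarrow> digits M (shift n x)"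
  by (simp add: digits_def)

lemma digits_reflect: "digits M x \<Longrightarrow> digits M (reflect M x)"
  by (simp add: digits_def)

lemma digits_splice_at: "digits M d \<Longrightarrow> digits M e \<Longrightarrow> digits M (splice_at n d e)"
  by (simp add: digits_def splice_at_def)

lemma digits_upd: "digits M d \<Longrightarrow> 0 \<le> k \<Longrightarrow> k \<le> M \<Longrightarrow> digits M (d(n := k))"
  by (simp add: digits_def)

lemma constant_sums:
  assumes "1 < q"
  shows "(\<lambda>i. real_of_int M / q ^ Suc i) sums (real_of_int M / (q - 1))"
proof -
  have "(\<lambda>i. (1 / q) ^ i) sums (1 / (1 - 1 / q))"
    using assms by (intro geometric_sums) auto
  then have "(\<lambda>i. real_of_int M / q * (1 / q) ^ i) sums (real_of_int M / q * (1 / (1 - 1 / q)))"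
    by (rule sums_mult)
  moreover have "real_of_int M / q * (1 / (1 - 1 / q)) = real_of_int M / (q - 1)"
    using assms by (simp add: field_simps)
  ultimately show ?thesis
    by (simp only: power_divide power_one times_divide_times_eq mult_1_right power_Suc)
qed

lemma digits_summable:
  assumes "1 < q" "digits M x"
  shows "summable (\<lambda>i. real_of_int (x i) / q ^ Suc i)"
proof (rule summable_comparison_test')
  show "summable (\<lambda>i. real_of_int M / q ^ Suc i)"
    using constant_sums[OF assms(1)] by (rule sums_summable)
  show "norm (real_of_int (x i) / q ^ Suc i) \<le> real_of_int M / q ^ Suc i" for i
    using assms by (auto simp: digits_def intro!: divide_right_mono)
qed

lemma digit_value_sums:
  assumes "1 < q" "digits M x"
  shows "(\<lambda>i. real_of_int (x i) / q ^ Suc i) sums digit_value q x"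
  unfolding digit_value_def using digits_summable[OF assms] by (rule summable_sums)

lemma expansion_iff:
  assumes "max_digit q M"
  shows "expansion q x c \<longleftrightarrow> digits M c \<and> digit_value q c = x"
proof -
  have "(real_of_int k < q) = (k \<le> M)" for k
    using assms unfolding max_digit_def by linarith
  then have "(\<forall>i. 0 \<le> c i \<and> real_of_int (c i) < q) \<longleftrightarrow> digits M c"
    by (simp add: digits_def)
  then show ?thesis
    unfolding expansion_def
    using digit_value_sums[OF max_digit_gt_1[OF assms]] sums_unique2 by blast
qed

lemma digit_value_nonneg:
  assumes "1 < q" "digits M x"
  shows "0 \<le> digit_value q x"
  unfolding digit_value_def using assms digits_summable[OF assms]
  by (intro suminf_nonneg) (auto simp: digits_def)

lemma digit_value_pos:
  assumes "1 < q" "digits M x" "x i \<noteq> 0"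
  shows "0 < digit_value q x"
  unfolding digit_value_def
proof (rule suminf_pos2[where i = i])
  show "summable (\<lambda>i. real_of_int (x i) / q ^ Suc i)"
    using assms(1,2) by (rule digits_summable)
  show "0 \<le> real_of_int (x n) / q ^ Suc n" for n
    using assms by (auto simp: digits_def)
  have "0 < x i"
    using assms(2,3) unfolding digits_def by (metis order_le_less)
  then show "0 < real_of_int (x i) / q ^ Suc i"
    using assms(1) by simp
qed

lemma digit_value_reflect:
  assumes "1 < q" "digits M x"
  shows "digit_value q (reflect M x) = real_of_int M / (q - 1) - digit_value q x"
proof -
  have "(\<lambda>i. real_of_int M / q ^ Suc i - real_of_int (x i) / q ^ Suc i) sums
      (real_of_int M / (q - 1) - digit_value q x)"
    by (intro sums_diff constant_sums[OF assms(1)] digit_value_sums[OF assms])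
  then have "(\<lambda>i. real_of_int (reflect M x i) / q ^ Suc i) sums
      (real_of_int M / (q - 1) - digit_value q x)"
    by (simp add: diff_divide_distrib)
  then show ?thesis
    unfolding digit_value_def by (simp add: sums_iff)
qed

lemma digit_value_le:
  assumes "1 < q" "digits M x"
  shows "digit_value q x \<le> real_of_int M / (q - 1)"
  using digit_value_nonneg[OF assms(1) digits_reflect[OF assms(2)]]
    digit_value_reflect[OF assms] by simp

lemma digit_value_split:
  assumes "1 < q" "digits M x"
  shows "digit_value q x =
    (\<Sum>i<n. real_of_int (x i) / q ^ Suc i) + digit_value q (shift n x) / q ^ n"
proof -
  have "(\<Sum>i. real_of_int (x (i + n)) / q ^ Suc (i + n)) = digit_value q (shift n x) / q ^ n"
    unfolding digit_value_def
    by (subst suminf_divide[OF digits_summable[OF assms(1) digits_shift[OF assms(2)]], symmetric])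
      (simp add: power_add field_simps)
  then show ?thesis
    unfolding digit_value_def using suminf_split_initial_segment[OF digits_summable[OF assms], of n]
    by (simp add: add.commute)
qed

lemma digit_value_Suc:
  assumes "1 < q" "digits M x"
  shows "digit_value q (shift (Suc n) x) = q * digit_value q (shift n x) - x n"
  using digit_value_split[OF assms(1) digits_shift[OF assms(2)], of n 1] assms(1)
  by (simp add: field_simps)

lemma digit_value_splice_at:
  assumes "1 < q" "digits M d" "digits M e"
  shows "digit_value q (splice_at n d e) =
    (\<Sum>i<n. real_of_int (d i) / q ^ Suc i) + digit_value q e / q ^ n"
  using digit_value_split[OF assms(1) digits_splice_at[OF assms(2,3)], of n n]
  unfolding shift_splice_at by (simp add: splice_at_def cong: sum.cong_simp)

lemma first_difference:
  fixes c d :: "nat \<Rightarrow> int"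
  assumes "c \<noteq> d"
  obtains n where "c n \<noteq> d n" "\<forall>i<n. c i = d i"
proof -
  have "\<exists>i. c i \<noteq> d i" using assms by auto
  then show thesis
    using that[of "LEAST i. c i \<noteq> d i"] LeastI_ex[of "\<lambda>i. c i \<noteq> d i"]
      not_less_Least[of _ "\<lambda>i. c i \<noteq> d i"] by blast
qed

lemma first_difference_value:
  assumes "1 < q" "digits M c" "digits M d" "\<forall>i<n. c i = d i"
  shows "digit_value q c - digit_value q d = (real_of_int (c n - d n) +
    digit_value q (shift (Suc n) c) - digit_value q (shift (Suc n) d)) / q ^ Suc n"
  using digit_value_split[OF assms(1,2), of "Suc n"] digit_value_split[OF assms(1,3), of "Suc n"] assms(4)
  by (simp add: add_divide_distrib diff_divide_distrib)

lemma infinite_tail_pos: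
  assumes "1 < q" "digits M x" "infinite_seq x"
  shows "0 < digit_value q (shift n x)"
proof -
  obtain i where "n \<le> i" "x i \<noteq> 0"
    using assms(3) unfolding infinite_seq_def infinite_nat_iff_unbounded_le by blast
  then show ?thesis
    using digit_value_pos[OF assms(1) digits_shift[OF assms(2)], of n "i - n"] by simp
qed

lemma infinite_seq_splice_at:
  assumes "infinite_seq e" shows "infinite_seq (splice_at n d e)"
  unfolding infinite_seq_def infinite_nat_iff_unbounded_le
proof
  fix k
  obtain i where "k \<le> i" "e i \<noteq> 0"
    using assms unfolding infinite_seq_def infinite_nat_iff_unbounded_le by blast
  then show "\<exists>i\<ge>k. i \<in> {i. splice_at n d e i \<noteq> 0}"
    by (intro exI[of _ "i + n"]) (simp add: splice_at_def)
qed

text \<open>The quasi-greedy algorithm always chooses the largest digit that leaves a positive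
  remainder. As the remainder never vanishes, the expansion is infinite.\<close>

lemma infinite_digits_exist:
  assumes q: "max_digit q M" and x: "0 < x" "x \<le> real_of_int M / (q - 1)"
  obtains c where "digits M c" "digit_value q c = x" "infinite_seq c"
proof -
  have q1: "1 < q" using q by (rule max_digit_gt_1)
  define dig where "dig y = min M (\<lceil>q * y\<rceil> - 1)" for y
  define r where "r = rec_nat x (\<lambda>_ y. q * y - real_of_int (dig y))"
  define c where "c i = dig (r i)" for i
  have r0: "r 0 = x" and rS: "r (Suc i) = q * r i - real_of_int (c i)" for i
    by (simp_all add: r_def c_def)
  have step: "0 \<le> dig y \<and> dig y \<le> M \<and> 0 < q * y - real_of_int (dig y) \<and>
      q * y - real_of_int (dig y) \<le> real_of_int M / (q - 1)"
    if y: "0 < y" "y \<le> real_of_int M / (q - 1)" for y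
  proof -
    have qy: "0 < q * y" using q1 y by simp
    have "0 \<le> dig y"
      using qy q unfolding dig_def max_digit_def by (auto; linarith)
    moreover have "0 < q * y - real_of_int (dig y)"
      unfolding dig_def by linarith
    moreover have "q * y - real_of_int (dig y) \<le> real_of_int M / (q - 1)"
    proof (cases "dig y = M")
      case True
      have "q * y \<le> q * (real_of_int M / (q - 1))"
        using y q1 by (intro mult_left_mono) auto
      also have "\<dots> = real_of_int M / (q - 1) + real_of_int M"
        using q1 by (simp add: field_simps)
      finally show ?thesis using True by simp
    next
      case False
      then have "q * y - real_of_int (dig y) \<le> 1"
        unfolding dig_def by linarith
      then show ?thesis using max_digit_quotient_ge_1[OF q] by linarith
    qed
    ultimately show ?thesis by (simp add: dig_def)
  qed
  have r: "0 < r i \<and> r i \<le> real_of_int M / (q - 1)" for i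
  proof (induction i)
    case 0 show ?case using x r0 by simp
  next
    case (Suc i) then show ?case using step[of "r i"] by (simp add: rS c_def)
  qed
  have c: "digits M c"
    using step r unfolding digits_def c_def by blast
  have partial: "(\<Sum>i<n. real_of_int (c i) / q ^ Suc i) = x - r n / q ^ n" for n
  proof (induction n)
    case 0 show ?case by (simp add: r0)
  next
    case (Suc n) then show ?case using q1 by (simp add: rS diff_divide_distrib)
  qed
  have bound: "(\<lambda>n. real_of_int M / (q - 1) * (1 / q) ^ n) \<longlonglongrightarrow> 0"
    by (intro tendsto_mult_right_zero LIMSEQ_power_zero) (use q1 in auto)
  have "norm (r n / q ^ n) \<le> real_of_int M / (q - 1) * (1 / q) ^ n" for n
  proof -
    have "r n / q ^ n \<le> real_of_int M / (q - 1) / q ^ n"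
      using r[of n] q1 by (intro divide_right_mono) auto
    then show ?thesis using r[of n] q1 by (simp add: power_divide)
  qed
  then have "(\<lambda>n. r n / q ^ n) \<longlonglongrightarrow> 0"
    by (intro Lim_null_comparison[OF _ bound] always_eventually) blast
  then have "(\<lambda>n. x - r n / q ^ n) \<longlonglongrightarrow> x - 0"
    by (intro tendsto_diff tendsto_const)
  then have "(\<lambda>i. real_of_int (c i) / q ^ Suc i) sums x"
    unfolding sums_def partial by simp
  then have val: "digit_value q c = x"
    unfolding digit_value_def by (simp add: sums_iff)
  have "infinite_seq c"
    unfolding infinite_seq_def infinite_nat_iff_unbounded_le
  proof (rule ccontr)
    assume "\<not> (\<forall>m. \<exists>n\<ge>m. n \<in> {i. c i \<noteq> 0})"
    then obtain m where m: "\<And>n. m \<le> n \<Longrightarrow> c n = 0" by auto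
    have "digit_value q c = x - r m / q ^ m"
      using digit_value_split[OF q1 c, of m] m unfolding partial by (simp add: digit_value_def)
    then show False using r[of m] q1 val by simp
  qed
  with c val show thesis by (rule that)
qed

lemma digits_exist:
  assumes q: "max_digit q M" and x: "0 \<le> x" "x \<le> real_of_int M / (q - 1)"
  obtains c where "digits M c" "digit_value q c = x"
proof (cases "x = 0")
  case True
  have "digits M (\<lambda>_. 0)" using q by (simp add: digits_def max_digit_def)
  then show thesis using that[of "\<lambda>_. 0"] True by (simp add: digit_value_def)
next
  case False
  then show thesis using infinite_digits_exist[OF q _ x(2)] x that by (metis order_le_less)
qed

lemma integer_base_unique:
  assumes "max_digit q M" "q = real_of_int M + 1" "digits M c" "digit_value q c = 1"
  shows "c = (\<lambda>_. M)"
proof (rule ccontr)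
  assume "c \<noteq> (\<lambda>_. M)"
  then obtain i where "reflect M c i \<noteq> 0" by fastforce
  then have "0 < digit_value q (reflect M c)"
    using digit_value_pos[OF max_digit_gt_1[OF assms(1)] digits_reflect[OF assms(3)]] by blast
  then show False
    using digit_value_reflect[OF max_digit_gt_1[OF assms(1)] assms(3)] assms
    by (simp add: max_digit_def)
qed

lemma univoque_iff:
  assumes "max_digit q M"
  shows "q \<in> univoque_bases \<longleftrightarrow> (\<forall>c d. digits M c \<longrightarrow> digits M d \<longrightarrow>
    digit_value q c = 1 \<longrightarrow> digit_value q d = 1 \<longrightarrow> c = d)"
proof -
  obtain c where "digits M c" "digit_value q c = 1"
    using digits_exist[OF assms, of 1] max_digit_quotient_ge_1[OF assms] by auto
  then show ?thesis
    unfolding univoque_bases_def mem_Collect_eq expansion_iff[OF assms]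
    using max_digit_gt_1[OF assms] by blast
qed

section \<open>Bases with two infinite expansions\<close>

text \<open>The number that the digits from position \<open>n\<close> on have to represent if an expansion of \<open>x\<close>
  starts with the first \<open>n\<close> digits of \<open>d\<close>. It is defined for every \<open>x\<close> and \<open>d\<close>, whether or not
  such an expansion exists.\<close>

definition remainder :: "real \<Rightarrow> nat \<Rightarrow> (nat \<Rightarrow> int) \<Rightarrow> real \<Rightarrow> real" where
  "remainder q n d x = q ^ n * (x - (\<Sum>i<n. real_of_int (d i) / q ^ Suc i))"

lemma remainder_digit_value:
  assumes "1 < q" "digits M d"
  shows "remainder q n d (digit_value q d) = digit_value q (shift n d)"
  using digit_value_split[OF assms, of n] assms(1) by (simp add: remainder_def)

lemma remainder_splice_at:
  assumes "1 < q" "digits M d" "digits M e" "digit_value q e = remainder q n d x"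
  shows "digit_value q (splice_at n d e) = x"
  using digit_value_splice_at[OF assms(1-3), of n] assms by (simp add: remainder_def)

lemma remainder_upd:
  assumes "0 < q"
  shows "remainder q (Suc n) (d(n := d n + 1)) x = remainder q (Suc n) d x - 1"
  using assms by (simp add: remainder_def field_simps)

lemma remainder_diff:
  "remainder q n d (x - y) = remainder q n d x - q ^ n * y"
  by (simp add: remainder_def algebra_simps)

text \<open>After \<open>d 0, \<dots>, d (n - 1)\<close>, both \<open>d n\<close> and \<open>d n + 1\<close> leave a number that has an expansion.\<close>

lemma two_digits_sequences:
  assumes q: "max_digit q M" and d: "digits M d" "d n < M"
    and rem: "1 \<le> remainder q (Suc n) d x" "remainder q (Suc n) d x \<le> real_of_int M / (q - 1)"
  obtains c c' where "digits M c" "digits M c'" "digit_value q c = x" "digit_value q c' = x" "c \<noteq> c'"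
proof -
  have q1: "1 < q" using q by (rule max_digit_gt_1)
  obtain e where e: "digits M e" "digit_value q e = remainder q (Suc n) d x"
    using digits_exist[OF q _ rem(2)] rem(1) by auto
  obtain e' where e': "digits M e'" "digit_value q e' = remainder q (Suc n) d x - 1"
    using digits_exist[OF q, of "remainder q (Suc n) d x - 1"] rem by auto
  define d' where "d' = d(n := d n + 1)"
  have d': "digits M d'"
    unfolding d'_def using d by (intro digits_upd) (auto simp: digits_def intro: add_nonneg_nonneg)
  show thesis
  proof
    show "digits M (splice_at (Suc n) d e)" "digits M (splice_at (Suc n) d' e')"
      using d d' e e' by (auto intro: digits_splice_at)
    show "digit_value q (splice_at (Suc n) d e) = x"
      using remainder_splice_at[OF q1 d(1) e] .
    show "digit_value q (splice_at (Suc n) d' e') = x"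
      using remainder_splice_at[OF q1 d' e'(1)] e'(2) remainder_upd q1 by (simp add: d'_def)
    have "splice_at (Suc n) d e n \<noteq> splice_at (Suc n) d' e' n"
      by (simp add: splice_at_def d'_def)
    then show "splice_at (Suc n) d e \<noteq> splice_at (Suc n) d' e'" by metis
  qed
qed

text \<open>With \<open>T\<close> the remainder and \<open>\<delta> = T - M / (q - 1)\<close>, the second inequality on \<open>T\<close> bounds the
  remainder of \<open>1 - \<delta>\<close> from below. It follows from the first one when \<open>\<delta> \<le> 0\<close>, and is needed only
  when \<open>\<delta> > 0\<close>. Both inequalities are strict, so they persist for nearby bases.\<close>

lemma not_univoque_of_remainder:
  assumes q: "max_digit q M" and d: "digits M d" "d n < M"
    and T: "1 < remainder q (Suc n) d 1"
    and T': "1 < remainder q (Suc n) d 1 - q ^ Suc n * (remainder q (Suc n) d 1 - real_of_int M / (q - 1))"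
  shows "q \<notin> univoque_bases"
proof (cases "remainder q (Suc n) d 1 \<le> real_of_int M / (q - 1)")
  case True
  obtain c c' where "digits M c" "digits M c'" "digit_value q c = 1" "digit_value q c' = 1" "c \<noteq> c'"
    by (rule two_digits_sequences[OF q d less_imp_le[OF T] True])
  then show ?thesis using univoque_iff[OF q] by blast
next
  case False
  have q1: "1 < q" using q by (rule max_digit_gt_1)
  define \<delta> where "\<delta> = remainder q (Suc n) d 1 - real_of_int M / (q - 1)"
  have \<delta>: "0 < \<delta>" using False by (simp add: \<delta>_def)
  have rem: "remainder q (Suc n) d (1 - \<delta>) = remainder q (Suc n) d 1 - q ^ Suc n * \<delta>"
    by (rule remainder_diff)
  \<comment> \<open>Two expansions of \<open>1 - \<delta>\<close>, placed after reflection behind \<open>d 0, \<dots>, d (n - 1), d n + 1\<close>,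
    give two expansions of \<open>1\<close>.\<close>
  have "1 * \<delta> \<le> q ^ Suc n * \<delta>"
    using q1 \<delta> by (intro mult_right_mono one_le_power) auto
  then have le: "remainder q (Suc n) d (1 - \<delta>) \<le> real_of_int M / (q - 1)"
    unfolding rem by (simp add: \<delta>_def)
  have ge: "1 \<le> remainder q (Suc n) d (1 - \<delta>)"
    unfolding rem using T' by (simp add: \<delta>_def)
  obtain c c' where c: "digits M c" "digits M c'" "digit_value q c = 1 - \<delta>"
      "digit_value q c' = 1 - \<delta>" "c \<noteq> c'"
    by (rule two_digits_sequences[OF q d ge le])
  define d' where "d' = d(n := d n + 1)"
  have d': "digits M d'"
    unfolding d'_def using d by (intro digits_upd) (auto simp: digits_def intro: add_nonneg_nonneg)
  have rem': "remainder q (Suc n) d' 1 = real_of_int M / (q - 1) - (1 - \<delta>)"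
    using remainder_upd[of q n d 1] q1 by (simp add: d'_def \<delta>_def)
  have val: "digit_value q (splice_at (Suc n) d' (reflect M b)) = 1"
    if "digits M b" "digit_value q b = 1 - \<delta>" for b
    using remainder_splice_at[OF q1 d' digits_reflect[OF that(1)], of "Suc n" 1]
      digit_value_reflect[OF q1 that(1)] that(2) rem' by simp
  have dig: "digits M (splice_at (Suc n) d' (reflect M b))" if "digits M b" for b
    using d' that by (intro digits_splice_at digits_reflect)
  have "splice_at (Suc n) d' (reflect M c) \<noteq> splice_at (Suc n) d' (reflect M c')"
    using c(5) by (metis shift_splice_at reflect_reflect)
  then show ?thesis
    using univoque_iff[OF q] val dig c by blast
qed

lemma closure_imp_unique_infinite:
  assumes q: "max_digit q M" and clos: "q \<in> closure univoque_bases"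
    and c: "digits M c" "digit_value q c = 1" "infinite_seq c"
    and d: "digits M d" "digit_value q d = 1" "infinite_seq d"
  shows "c = d"
proof (cases "q = real_of_int M + 1")
  case True
  then show ?thesis
    using integer_base_unique[OF q _ c(1,2)] integer_base_unique[OF q _ d(1,2)] by simp
next
  case False
  have q1: "1 < q" using q by (rule max_digit_gt_1)
  have qM: "real_of_int M < q" "q < real_of_int M + 1" "1 \<le> M"
    using q False by (auto simp: max_digit_def)
  have no_less: False
    if c: "digits M c" "digit_value q c = 1" "infinite_seq c"
      and d: "digits M d" "digit_value q d = 1"
      and n: "\<And>i. i < n \<Longrightarrow> c i = d i" "d n < c n" for c d n
  proof -
    let ?T = "\<lambda>q. remainder q (Suc n) d 1"
    let ?T' = "\<lambda>q. ?T q - q ^ Suc n * (?T q - real_of_int M / (q - 1))"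
    have Td: "?T q = digit_value q (shift (Suc n) d)"
      using remainder_digit_value[OF q1 d(1), of "Suc n"] d(2) by simp
    have "?T q - remainder q (Suc n) c 1 = real_of_int (c n - d n)"
      using n(1) q1 by (simp add: remainder_def field_simps)
    \<comment> \<open>If \<open>c\<close> were finite, this could be an equality.\<close>
    moreover have "0 < remainder q (Suc n) c 1"
      using remainder_digit_value[OF q1 c(1), of "Suc n"] c(2) infinite_tail_pos[OF q1 c(1,3)] by simp
    moreover have "1 \<le> real_of_int (c n - d n)" using n(2) by simp
    ultimately have T: "1 < ?T q" by linarith
    have Tle: "?T q \<le> real_of_int M / (q - 1)"
      unfolding Td using digit_value_le[OF q1 digits_shift[OF d(1)]] .
    have "q ^ Suc n * (?T q - real_of_int M / (q - 1)) \<le> 0"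
      using Tle q1 by (intro mult_nonneg_nonpos) auto
    then have T': "1 < ?T' q" using T by linarith
    have "c n \<le> M" using c(1) by (simp add: digits_def)
    then have dn: "d n < M" using n(2) by simp
    have cont: "isCont ?T q" "isCont ?T' q"
      unfolding remainder_def using q1 by (auto intro!: continuous_intros)
    have "eventually (\<lambda>q'. 1 < ?T q') (nhds q)" "eventually (\<lambda>q'. 1 < ?T' q') (nhds q)"
      using order_tendstoD(1)[OF cont(1)[unfolded isCont_def, THEN tendsto_at_iff_tendsto_nhds[THEN iffD1]] T]
        order_tendstoD(1)[OF cont(2)[unfolded isCont_def, THEN tendsto_at_iff_tendsto_nhds[THEN iffD1]] T'] .
    moreover have "eventually (\<lambda>q'. real_of_int M < q') (nhds q)" "eventually (\<lambda>q'. q' < real_of_int M + 1) (nhds q)"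
      using qM by (auto intro!: order_tendstoD[OF filterlim_ident])
    ultimately have "eventually (\<lambda>q'. q' \<notin> univoque_bases) (nhds q)"
    proof eventually_elim
      case (elim q')
      then have "max_digit q' M" using qM by (simp add: max_digit_def)
      then show ?case using not_univoque_of_remainder[OF _ d(1) dn] elim by blast
    qed
    then obtain S where "open S" "q \<in> S" "S \<inter> univoque_bases = {}"
      unfolding eventually_nhds by blast
    then show False
      using clos open_Int_closure_eq_empty[of S univoque_bases] by blast
  qed
  show ?thesis
  proof (rule ccontr)
    assume "c \<noteq> d"
    then obtain n where n: "c n \<noteq> d n" "\<forall>i<n. c i = d i"
      by (rule first_difference)
    show False
    proof (cases "d n < c n")
      case True then show False using no_less[OF c d(1,2), of n] n(2) by blast
    next
      case False
      with n(1) have "c n < d n" by simp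
      then show False using no_less[OF d c(1,2), of n] n(2) by simp
    qed
  qed
qed

section \<open>Lexicographic comparison and values\<close>

text \<open>The prefix of length \<open>n\<close> of \<open>x\<close> is lexicographically strictly smaller than that of \<open>y\<close>.\<close>

definition lex_less :: "nat \<Rightarrow> (nat \<Rightarrow> int) \<Rightarrow> (nat \<Rightarrow> int) \<Rightarrow> bool" where
  "lex_less n x y \<longleftrightarrow> (\<exists>j<n. (\<forall>l<j. x l = y l) \<and> x j < y j)"

text \<open>The non-strict lexicographic order on infinite sequences.\<close>

definition lex_le :: "(nat \<Rightarrow> int) \<Rightarrow> (nat \<Rightarrow> int) \<Rightarrow> bool" where
  "lex_le x y \<longleftrightarrow> (\<forall>j. (\<forall>l<j. x l = y l) \<longrightarrow> x j \<le> y j)"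

lemma lex_lessI: "j < n \<Longrightarrow> (\<And>l. l < j \<Longrightarrow> x l = y l) \<Longrightarrow> x j < y j \<Longrightarrow> lex_less n x y"
  unfolding lex_less_def by blast

lemma lex_lessE:
  assumes "lex_less n x y"
  obtains j where "j < n" "\<And>l. l < j \<Longrightarrow> x l = y l" "x j < y j"
  using assms unfolding lex_less_def by blast

lemma lex_less_mono: "lex_less n x y \<Longrightarrow> n \<le> k \<Longrightarrow> lex_less k x y"
  unfolding lex_less_def using order_less_le_trans by blast

lemma lex_less_cong:
  assumes "lex_less n x y" "\<And>l. l < n \<Longrightarrow> x' l = x l" "\<And>l. l < n \<Longrightarrow> y' l = y l"
  shows "lex_less n x' y'"
proof -
  obtain j where j: "j < n" "\<And>l. l < j \<Longrightarrow> x l = y l" "x j < y j"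
    using assms(1) by (rule lex_lessE) blast
  show ?thesis by (rule lex_lessI[of j]) (use j assms(2,3) in auto)
qed

lemma lex_le_cases:
  assumes "lex_le x y"
  shows "lex_less n x y \<or> (\<forall>l<n. x l = y l)"
proof (induction n)
  case 0 show ?case by simp
next
  case (Suc n)
  show ?case
  proof (cases "lex_less n x y")
    case True then show ?thesis using lex_less_mono[of n x y "Suc n"] by simp
  next
    case False
    then have eq: "\<forall>l<n. x l = y l" using Suc by blast
    then have "x n \<le> y n" using assms unfolding lex_le_def by blast
    then consider "x n = y n" | "x n < y n" by linarith
    then show ?thesis
    proof cases
      case 1 then show ?thesis using eq less_Suc_eq by metis
    next
      case 2 then show ?thesis using eq lex_lessI[of n "Suc n" x y] by blast
    qed
  qed
qed

lemma lex_less_le_trans: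
  assumes "lex_less n x y" "lex_le y z"
  shows "lex_less n x z"
proof -
  obtain j where j: "j < n" "\<And>l. l < j \<Longrightarrow> x l = y l" "x j < y j"
    using assms(1) by (rule lex_lessE) blast
  show ?thesis
  proof (cases "lex_less j y z")
    case True
    then have "lex_less j x z" by (rule lex_less_cong) (use j in auto)
    then show ?thesis using lex_less_mono j(1) by (meson less_imp_le)
  next
    case False
    then have eq: "\<forall>l<j. y l = z l" using lex_le_cases[OF assms(2)] by blast
    then have "y j \<le> z j" using assms(2) unfolding lex_le_def by blast
    then show ?thesis by (intro lex_lessI[of j]) (use eq j in auto)
  qed
qed

lemma lex_le_neq:
  assumes "lex_le x y" "x \<noteq> y"
  shows "\<exists>n. lex_less n x y"
proof -
  obtain j where j: "x j \<noteq> y j" "\<forall>i<j. x i = y i"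
    using first_difference[OF assms(2)] .
  then have "x j < y j" using assms(1) unfolding lex_le_def by (simp add: order_less_le)
  then have "lex_less (Suc j) x y" by (intro lex_lessI[of j]) (use j in auto)
  then show ?thesis ..
qed

text \<open>If all proper tails of \<open>x\<close> are lexicographically below \<open>c\<close>, their values are below that of
  \<open>c\<close>. Lexicographic order alone does not give this in a non-integer base; but a tail whose value
  exceeds \<open>1\<close> by \<open>u \<ge> 0\<close> is followed by one whose value exceeds \<open>1\<close> by more than \<open>q * u\<close>, which
  contradicts the boundedness of the values.\<close>

lemma lex_less_tail_value:
  assumes q1: "1 < q" and c: "digits M c" "digit_value q c = 1"
    and pos: "\<And>n. 0 < digit_value q (shift n c)"
    and x: "digits M x" and lex: "\<And>i. 1 \<le> i \<Longrightarrow> \<exists>n. lex_less n (shift i x) c"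
    and i: "1 \<le> i"
  shows "digit_value q (shift i x) < 1"
proof (rule ccontr)
  define u where "u i = digit_value q (shift i x) - 1" for i
  have step: "\<exists>i'\<ge>1. q * u i < u i'" if i: "1 \<le> i" and ui: "0 \<le> u i" for i
  proof -
    obtain n where "lex_less n (shift i x) c" using lex i by blast
    then obtain j where j: "\<forall>l<j. shift i x l = c l" "shift i x j < c j"
      unfolding lex_less_def by blast
    \<comment> \<open>The tail after the first difference is the one with the larger excess.\<close>
    let ?i = "i + Suc j"
    have "u i = (real_of_int (shift i x j - c j) + digit_value q (shift ?i x)
        - digit_value q (shift (Suc j) c)) / q ^ Suc j"
      using first_difference_value[where c = "shift i x", OF q1 digits_shift[OF x] c(1) j(1)] c(2) by (simp add: u_def)
    then have "q ^ Suc j * u i = real_of_int (shift i x j - c j) + digit_value q (shift ?i x)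
        - digit_value q (shift (Suc j) c)"
      using q1 by simp
    moreover have "real_of_int (shift i x j - c j) \<le> -1" using j(2) by simp
    ultimately have "q ^ Suc j * u i < u ?i" using pos[of "Suc j"] by (simp only: u_def)
    moreover have "q * u i \<le> q ^ Suc j * u i"
      using q1 ui by (intro mult_right_mono) auto
    ultimately have "q * u i < u ?i" by linarith
    then show ?thesis by (intro exI[of _ ?i]) simp
  qed
  assume "\<not> digit_value q (shift i x) < 1"
  then have "0 \<le> u i" by (simp add: u_def)
  then obtain k where k: "1 \<le> k" "q * u i < u k" using step i by blast
  have "0 \<le> q * u i" using \<open>0 \<le> u i\<close> q1 by simp
  then have uk: "0 < u k" using k(2) by linarith
  have grow: "\<exists>i'\<ge>1. q ^ n * u k \<le> u i'" for n
  proof (induction n)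
    case 0 show ?case using k by auto
  next
    case (Suc n)
    then obtain i' where i': "1 \<le> i'" "q ^ n * u k \<le> u i'" by blast
    moreover have "0 < q ^ n * u k" using q1 uk by simp
    ultimately obtain i'' where "1 \<le> i''" "q * u i' < u i''" using step[of i'] by fastforce
    moreover have "q * (q ^ n * u k) \<le> q * u i'" using i' q1 by (intro mult_left_mono) auto
    ultimately show ?case by (intro exI[of _ i'']) (simp add: mult.assoc)
  qed
  obtain n where "real_of_int M / (q - 1) / u k < q ^ n" using real_arch_pow[OF q1] by blast
  then have "real_of_int M / (q - 1) < q ^ n * u k" by (simp only: pos_divide_less_eq[OF uk])
  moreover obtain i' where "q ^ n * u k \<le> u i'" using grow by blast
  ultimately show False
    using digit_value_le[OF q1 digits_shift[OF x], of i'] by (simp add: u_def)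
qed

text \<open>A second expansion would have at its first difference a larger or a smaller digit. The former
  is impossible if the tails of \<open>c\<close> are worth less than \<open>1\<close>, the latter if the reflected tails are.\<close>

lemma univoque_of_lex:
  assumes q: "max_digit q M" and c: "digits M c" "digit_value q c = 1"
    and up: "\<And>i. 1 \<le> i \<Longrightarrow> \<exists>n. lex_less n (shift i c) c"
    and down: "\<And>i. 1 \<le> i \<Longrightarrow> \<exists>n. lex_less n (reflect M (shift i c)) c"
  shows "q \<in> univoque_bases"
proof -
  have q1: "1 < q" using q by (rule max_digit_gt_1)
  have pos: "0 < digit_value q (shift n c)" for n
  proof -
    obtain k where "lex_less k (reflect M (shift (Suc n) c)) c" using down by fastforce
    then obtain j where j: "M - c (Suc n + j) < c j" by (rule lex_lessE) simp
    moreover have "c j \<le> M" using c(1) by (simp add: digits_def)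
    ultimately have "shift n c (Suc j) \<noteq> 0" by simp
    then show ?thesis using digit_value_pos[OF q1 digits_shift[OF c(1)]] by blast
  qed
  have tail: "digit_value q (shift (Suc i) c) < 1" for i
    using lex_less_tail_value[OF q1 c pos c(1) up] by simp
  have tail': "digit_value q (reflect M (shift (Suc i) c)) < 1" for i
    using lex_less_tail_value[OF q1 c pos digits_reflect[OF c(1)]] down by (simp add: shift_reflect)
  have "d = c" if d: "digits M d" "digit_value q d = 1" for d
  proof (rule ccontr)
    assume "d \<noteq> c"
    then obtain n where n: "d n \<noteq> c n" "\<forall>i<n. d i = c i"
      by (rule first_difference)
    have diff: "real_of_int (d n - c n) + digit_value q (shift (Suc n) d) = digit_value q (shift (Suc n) c)"
      using first_difference_value[OF q1 d(1) c(1) n(2)] d(2) c(2) q1 by simp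
    consider "d n - c n \<ge> 1" | "d n - c n \<le> -1" using n(1) by linarith
    then show False
    proof cases
      case 1
      then have "real_of_int (d n - c n) \<ge> 1" by linarith
      then show False
        using diff tail[of n] digit_value_nonneg[OF q1 digits_shift[OF d(1)], of "Suc n"] by linarith
    next
      case 2
      then have "real_of_int (d n - c n) \<le> -1" by linarith
      then show False
        using diff tail'[of n] digit_value_reflect[OF q1 digits_shift[OF c(1)], of "Suc n"]
          digit_value_le[OF q1 digits_shift[OF d(1)], of "Suc n"] by linarith
    qed
  qed
  then show ?thesis using univoque_iff[OF q] by metis
qed

section \<open>The unique infinite expansion\<close>

text \<open>The digit \<open>a n\<close> can be changed to \<open>k\<close>, in an infinite expansion of the same number, whenever
  the correspondingly adjusted tail is positive and at most \<open>M / (q - 1)\<close>. Excluding \<open>a n + 1\<close> and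
  \<open>a n - 1\<close> gives the two bounds after digits below \<open>M\<close> and above \<open>0\<close> respectively; \<open>q \<le> M + 1\<close>
  carries the bounds across the digits \<open>M\<close> and \<open>0\<close>.\<close>

lemma unique_infinite_tails:
  assumes q: "max_digit q M" and a: "digits M a" "digit_value q a = 1" "infinite_seq a"
    and uniq: "\<And>c. digits M c \<Longrightarrow> digit_value q c = 1 \<Longrightarrow> infinite_seq c \<Longrightarrow> c = a"
  shows "digit_value q (shift n a) \<le> 1" "digit_value q (reflect M (shift n a)) < 1" "a 0 = M"
proof -
  have q1: "1 < q" using q by (rule max_digit_gt_1)
  have qM: "real_of_int M < q" "q \<le> real_of_int M + 1" "1 \<le> M"
    using q by (auto simp: max_digit_def)
  let ?t = "\<lambda>n. digit_value q (shift n a)"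
  have a_range: "0 \<le> a n" "a n \<le> M" for n using a(1) by (auto simp: digits_def)
  have t_pos: "0 < ?t n" for n using infinite_tail_pos[OF q1 a(1,3)] .
  have t_le: "?t n \<le> real_of_int M / (q - 1)" for n using digit_value_le[OF q1 digits_shift[OF a(1)]] .
  have t0: "?t 0 = 1" using a(2) by simp
  have t_Suc: "?t (Suc n) = q * ?t n - a n" for n by (rule digit_value_Suc[OF q1 a(1)])
  have change: False
    if k: "0 \<le> k" "k \<le> M" "k \<noteq> a n"
      and t: "0 < ?t (Suc n) + real_of_int (a n - k)" "?t (Suc n) + real_of_int (a n - k) \<le> real_of_int M / (q - 1)"
    for n k
  proof -
    obtain e where e: "digits M e" "digit_value q e = ?t (Suc n) + real_of_int (a n - k)" "infinite_seq e"
      using infinite_digits_exist[OF q t] .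
    let ?c = "splice_at (Suc n) (a(n := k)) e"
    have d: "digits M (a(n := k))" using a(1) k by (intro digits_upd)
    have c: "digits M ?c" using d e by (intro digits_splice_at)
    have cn: "?c n = k" and ca: "\<forall>i<n. a i = ?c i" by (simp_all add: splice_at_def)
    have "digit_value q a - digit_value q ?c = 0"
      using first_difference_value[OF q1 a(1) c ca] unfolding shift_splice_at cn e(2) by simp
    then have "?c = a" using uniq[OF c] a(2) infinite_seq_splice_at[OF e(3)] by simp
    then show False using cn k(3) by simp
  qed
  have t_le_1: "?t n \<le> 1" for n
  proof (induction n)
    case 0 show ?case using t0 by simp
  next
    case (Suc n)
    show ?case
    proof (cases "a n = M")
      case True
      have "q * ?t n \<le> q * 1" using mult_left_mono[OF Suc, of q] q1 by linarith
      then show ?thesis using True qM t_Suc[of n] by linarith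
    next
      case False
      then have k: "0 \<le> a n + 1" "a n + 1 \<le> M" "a n + 1 \<noteq> a n" using a_range[of n] by auto
      show ?thesis
      proof (rule ccontr)
        assume "\<not> ?t (Suc n) \<le> 1"
        then show False using change[OF k] t_le[of "Suc n"] by simp
      qed
    qed
  qed
  show a0: "a 0 = M"
    using t_le_1[of 1] t_Suc[of 0] t0 qM a_range(2)[of 0] by simp
  have down: "real_of_int M / (q - 1) - ?t (Suc n) < 1" if "a n \<noteq> 0" for n
  proof (rule ccontr)
    assume "\<not> ?thesis"
    moreover have "0 \<le> a n - 1" "a n - 1 \<le> M" "a n - 1 \<noteq> a n"
      using that a_range[of n] by auto
    ultimately show False using change[of "a n - 1" n] t_pos[of "Suc n"] by simp
  qed
  have r_less_1: "real_of_int M / (q - 1) - ?t n < 1" for n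
  proof (induction n)
    case 0
    show ?case using down[of 0] t_Suc[of 0] a0 qM t0 by simp
  next
    case (Suc n)
    show ?case
    proof (cases "a n = 0")
      case True
      have "real_of_int M / (q - 1) - ?t (Suc n) = q * (real_of_int M / (q - 1) - ?t n) - M"
        unfolding t_Suc using True q1 by (simp add: field_simps)
      also have "\<dots> < q * 1 - M"
        using mult_strict_left_mono[OF Suc, of q] q1 by linarith
      finally show ?thesis using qM by linarith
    next
      case False then show ?thesis by (rule down)
    qed
  qed
  show "?t n \<le> 1" by (rule t_le_1)
  show "digit_value q (reflect M (shift n a)) < 1"
    using r_less_1[of n] digit_value_reflect[OF q1 digits_shift[OF a(1)], of n] by simp
qed

text \<open>If no tail of \<open>a\<close> is worth more than \<open>1\<close>, then the tail of \<open>a\<close> does not make up for a smaller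
  digit, and a sequence lexicographically above \<open>a\<close> is worth at least \<open>1\<close>, plus what its own tail
  contributes.\<close>

lemma not_lex_le_value:
  assumes q1: "1 < q" and x: "digits M x" and a: "digits M a" "digit_value q a = 1"
    and t: "\<And>n. digit_value q (shift n a) \<le> 1" and not_le: "\<not> lex_le x a"
  obtains j where "1 + digit_value q (shift j x) / q ^ j \<le> digit_value q x"
proof -
  obtain j where j: "\<forall>l<j. x l = a l" "a j < x j"
    using not_le unfolding lex_le_def by (meson linorder_not_le)
  have "real_of_int (x j - a j) \<ge> 1" using j(2) by simp
  then have "digit_value q (shift (Suc j) x) / q ^ Suc j \<le> (real_of_int (x j - a j) +
      digit_value q (shift (Suc j) x) - digit_value q (shift (Suc j) a)) / q ^ Suc j"
    using t[of "Suc j"] q1 by (intro divide_right_mono) auto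
  then show thesis
    using that[of "Suc j"] first_difference_value[OF q1 x a(1) j(1)] a(2) by simp
qed

lemma lex_of_tails:
  assumes q1: "1 < q" and a: "digits M a" "digit_value q a = 1" "infinite_seq a"
    and t: "\<And>n. digit_value q (shift n a) \<le> 1"
    and r: "\<And>n. digit_value q (reflect M (shift n a)) < 1"
  shows "lex_le (shift i a) a" "\<exists>n. lex_less n (reflect M (shift i a)) a"
proof -
  show "lex_le (shift i a) a"
  proof (rule ccontr)
    assume "\<not> ?thesis"
    then obtain j where "1 + digit_value q (shift j (shift i a)) / q ^ j \<le> digit_value q (shift i a)"
      by (rule not_lex_le_value[OF q1 digits_shift[OF a(1)] a(1,2) t])
    moreover have "0 < digit_value q (shift j (shift i a)) / q ^ j"
      using infinite_tail_pos[OF q1 a(1,3)] q1 by simp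
    ultimately show False using t[of i] by linarith
  qed
  let ?x = "reflect M (shift i a)"
  have x: "digits M ?x" by (intro digits_reflect digits_shift a)
  have "lex_le ?x a"
  proof (rule ccontr)
    assume "\<not> ?thesis"
    then obtain j where "1 + digit_value q (shift j ?x) / q ^ j \<le> digit_value q ?x"
      by (rule not_lex_le_value[OF q1 x a(1,2) t])
    moreover have "0 \<le> digit_value q (shift j ?x) / q ^ j"
      using digit_value_nonneg[OF q1 digits_shift[OF x]] q1 by simp
    ultimately show False using r[of i] by linarith
  qed
  moreover have "?x \<noteq> a" using r[of i] a(2) by force
  ultimately show "\<exists>n. lex_less n ?x a" by (rule lex_le_neq)
qed

section \<open>Univoque sequences with a prescribed prefix\<close>

text \<open>If length \<open>N\<close> fails, take the first position \<open>i\<close> from which the reflected digits agree with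
  \<open>a\<close> up to \<open>N\<close>, and extend the prefix just beyond the place where that agreement ends. From a later
  position \<open>i + s\<close> the reflected digits are then smaller than the tail of \<open>a\<close> at \<open>s\<close>, which is at
  most \<open>a\<close>.\<close>

lemma strict_prefix_exists:
  assumes le: "\<And>i. lex_le (shift i a) a"
    and less: "\<And>i. \<exists>n. lex_less n (reflect M (shift i a)) a"
  obtains m where "N \<le> m" "\<And>i. i < m \<Longrightarrow> lex_less (m - i) (reflect M (shift i a)) a"
proof (cases "\<forall>i<N. lex_less (N - i) (reflect M (shift i a)) a")
  case True then show thesis using that[of N] by simp
next
  case False
  define bad where "bad i \<longleftrightarrow> i < N \<and> \<not> lex_less (N - i) (reflect M (shift i a)) a" for i
  define i where "i = (LEAST i. bad i)"
  have "\<exists>i. bad i" using False unfolding bad_def by blast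
  then have i: "bad i" unfolding i_def by (rule LeastI_ex)
  have small: "\<not> bad k" if "k < i" for k using that unfolding i_def by (rule not_less_Least)
  obtain n where "lex_less n (reflect M (shift i a)) a" using less by blast
  then obtain j where j: "\<And>l. l < j \<Longrightarrow> reflect M (shift i a) l = a l" "reflect M (shift i a) j < a j"
    by (rule lex_lessE) blast
  have Nj: "N \<le> i + j"
  proof (rule ccontr)
    assume "\<not> ?thesis"
    then have "lex_less (N - i) (reflect M (shift i a)) a"
      by (intro lex_lessI[of j]) (use j in auto)
    then show False using i by (simp add: bad_def)
  qed
  show thesis
  proof (rule that[of "Suc (i + j)"])
    show "N \<le> Suc (i + j)" using Nj by simp
    fix k assume k: "k < Suc (i + j)"
    show "lex_less (Suc (i + j) - k) (reflect M (shift k a)) a"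
    proof (cases "k < i")
      case True
      then have "lex_less (N - k) (reflect M (shift k a)) a"
        using small[of k] i by (simp add: bad_def)
      then show ?thesis by (rule lex_less_mono) (use Nj in simp)
    next
      case False
      define s where "s = k - i"
      have s: "k = i + s" "s \<le> j" using False k by (auto simp: s_def)
      have "lex_less (Suc (i + j) - k) (reflect M (shift k a)) (shift s a)"
        by (rule lex_lessI[of "j - s"]) (use s j(1)[of "s + _"] j(2) in \<open>auto simp: add.assoc\<close>)
      then show ?thesis using le by (rule lex_less_le_trans)
    qed
  qed
qed

text \<open>Entry \<open>k\<close> of the block number \<open>b\<close>, where the blocks have length \<open>m\<close>. With \<open>p\<close> the prefix of
  length \<open>m\<close> of \<open>a\<close>, blocks \<open>0, 3, 5, 7, \<dots>\<close> equal \<open>p\<close>, blocks \<open>2, 4, 6, \<dots>\<close> equal its reflection, and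
  block \<open>1\<close> equals its reflection with the last digit increased by one.\<close>

definition twisted_block :: "int \<Rightarrow> (nat \<Rightarrow> int) \<Rightarrow> nat \<Rightarrow> nat \<Rightarrow> nat \<Rightarrow> int" where
  "twisted_block M a m b k =
    (if b = 0 \<or> odd b \<and> b \<noteq> 1 then a k
     else if b = 1 \<and> Suc k = m then M - a k + 1 else M - a k)"

text \<open>The concatenation of these blocks.\<close>

definition twisted :: "int \<Rightarrow> (nat \<Rightarrow> int) \<Rightarrow> nat \<Rightarrow> nat \<Rightarrow> int" where
  "twisted M a m n = twisted_block M a m (n div m) (n mod m)"

lemma twisted_at: "k < m \<Longrightarrow> twisted M a m (b * m + k) = twisted_block M a m b k"
  by (simp add: twisted_def)

lemma twisted_prefix: "k < m \<Longrightarrow> twisted M a m k = a k"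
  using twisted_at[of k m M a 0] by (simp add: twisted_block_def)

lemma shift_twisted: "k + l < m \<Longrightarrow> shift (b * m + k) (twisted M a m) l = twisted_block M a m b (k + l)"
  using twisted_at[of "k + l" m M a b] by (simp add: add.assoc)

lemma shift_twisted_next:
  assumes "k \<le> m" "l < m"
  shows "shift (b * m + k) (twisted M a m) (m - k + l) = twisted_block M a m (Suc b) l"
  using twisted_at[of l m M a "Suc b"] assms by (simp add: algebra_simps)

text \<open>Throughout, \<open>m\<close> is a length at which the inequalities for the reflected tails are already
  strict inside the prefix.\<close>

context
  fixes M :: int and a :: "nat \<Rightarrow> int" and m :: nat
  assumes le: "\<And>i. lex_le (shift i a) a"
    and strict: "\<And>i. i < m \<Longrightarrow> lex_less (m - i) (reflect M (shift i a)) a"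
    and a: "digits M a" "a 0 = M" and M: "1 \<le> M" and m: "2 \<le> m"
begin

lemma digits_twisted: "digits M (twisted M a m)"
proof -
  have "lex_less 1 (reflect M (shift (m - 1) a)) a" using strict[of "m - 1"] m by simp
  then have "M - a (m - 1) < a 0" by (rule lex_lessE) simp
  then have last: "1 \<le> a k" if "Suc k = m" for k using a(2) that by auto
  have "0 \<le> twisted_block M a m b k \<and> twisted_block M a m b k \<le> M" for b k
  proof -
    have "0 \<le> a k" "a k \<le> M" using a(1) by (simp_all add: digits_def)
    then show ?thesis using last[of k] by (simp add: twisted_block_def)
  qed
  then show ?thesis by (simp add: digits_def twisted_def)
qed

text \<open>The comparison of \<open>a\<close> with a sequence \<open>y\<close> that starts inside a block, at offset \<open>k\<close>: if the
  rest of the block does not decide it, the beginning of the reflected block that follows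
  is smaller than the last \<open>k\<close> digits of the prefix.\<close>

lemma lex_less_overlap:
  assumes k: "0 < k" "k < m"
    and y: "lex_less (m - k) y a \<or> (\<forall>l<m - k. y l = a l)" "\<And>l. l < k \<Longrightarrow> y (m - k + l) = M - a l"
  shows "lex_less m y a"
  using y(1)
proof
  assume "lex_less (m - k) y a" then show ?thesis by (rule lex_less_mono) simp
next
  assume eq: "\<forall>l<m - k. y l = a l"
  have "lex_less k (reflect M (shift (m - k) a)) a" using strict[of "m - k"] k by simp
  then obtain j where j: "j < k" "\<And>l. l < j \<Longrightarrow> M - a (m - k + l) = a l" "M - a (m - k + j) < a j"
    by (rule lex_lessE) simp
  show ?thesis
  proof (rule lex_lessI[of "m - k + j"])
    show "m - k + j < m" using j(1) k by simp
    show "y (m - k + j) < a (m - k + j)" using y(2) j by simp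
    fix l assume l: "l < m - k + j"
    show "y l = a l"
    proof (cases "l < m - k")
      case True then show ?thesis using eq by simp
    next
      case False
      then have "l - (m - k) < j" "l = m - k + (l - (m - k))" using l by auto
      then show ?thesis using y(2)[of "l - (m - k)"] j(2)[of "l - (m - k)"] j(1) by simp
    qed
  qed
qed

lemma lex_less_twisted: "lex_less m y a \<Longrightarrow> \<exists>n. lex_less n y (twisted M a m)"
  using lex_less_cong[of m y a y "twisted M a m"] twisted_prefix by blast

text \<open>The increased digit of block \<open>1\<close> serves here: a block \<open>p\<close> followed by its plain reflection
  agrees with the beginning of the twisted sequence up to position \<open>2 * m - 1\<close>, where it is smaller
  by one.\<close>

lemma lex_less_twisted_start:
  assumes "\<And>l. l < m \<Longrightarrow> y l = a l" "\<And>l. l < m \<Longrightarrow> y (m + l) = M - a l"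
  shows "\<exists>n. lex_less n y (twisted M a m)"
proof -
  have c: "twisted M a m (m + l) = (if Suc l = m then M - a l + 1 else M - a l)" if "l < m" for l
    using twisted_at[OF that, of M a 1] by (simp add: twisted_block_def)
  have "lex_less (2 * m) y (twisted M a m)"
  proof (rule lex_lessI[of "m + (m - 1)"])
    show "m + (m - 1) < 2 * m" using m by simp
    show "y (m + (m - 1)) < twisted M a m (m + (m - 1))"
      using assms(2)[of "m - 1"] c[of "m - 1"] m by simp
    fix l assume l: "l < m + (m - 1)"
    show "y l = twisted M a m l"
    proof (cases "l < m")
      case True then show ?thesis using assms(1) twisted_prefix by simp
    next
      case False then show ?thesis using l assms(2)[of "l - m"] c[of "l - m"] by simp
    qed
  qed
  then show ?thesis ..
qed

text \<open>A start inside a block \<open>p\<close> that is followed by a reflected block. Only \<open>k < m\<close> digits of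
  the latter are used, so it may also be the one with the increased last digit.\<close>

lemma lex_less_overlap_pos:
  assumes k: "0 < k" "k < m"
    and y: "\<And>l. k + l < m \<Longrightarrow> y l = a (k + l)" "\<And>l. l < k \<Longrightarrow> y (m - k + l) = M - a l"
  shows "lex_less m y a"
proof (rule lex_less_overlap[OF k _ y(2)])
  show "lex_less (m - k) y a \<or> (\<forall>l<m - k. y l = a l)"
    using lex_le_cases[OF le, of "m - k" k]
  proof
    assume "lex_less (m - k) (shift k a) a"
    then have "lex_less (m - k) y a" by (rule lex_less_cong) (use y(1) in auto)
    then show ?thesis ..
  next
    assume "\<forall>l<m - k. shift k a l = a l"
    then show ?thesis using y(1) by simp
  qed
qed

text \<open>A start at offset \<open>k\<close> of a plain reflected block.\<close>

lemma lex_less_neg: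
  assumes "k < m" "\<And>l. k + l < m \<Longrightarrow> y l = M - a (k + l)"
  shows "lex_less m y a"
proof -
  have "lex_less (m - k) y a" using strict[OF assms(1)] by (rule lex_less_cong) (use assms(2) in auto)
  then show ?thesis by (rule lex_less_mono) simp
qed

lemma shift_twisted_lex_less:
  assumes "1 \<le> i"
  shows "\<exists>n. lex_less n (shift i (twisted M a m)) (twisted M a m)"
proof -
  define b k where "b = i div m" and "k = i mod m"
  have i: "i = b * m + k" and k: "k < m" using m by (auto simp: b_def k_def)
  let ?y = "shift i (twisted M a m)"
  have y: "?y l = twisted_block M a m b (k + l)" if "k + l < m" for l
    using shift_twisted[OF that] i by simp
  have y': "?y (m - k + l) = twisted_block M a m (Suc b) l" if "l < m" for l
    using shift_twisted_next[of k m l b M a] that k i by simp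
  consider "b = 0 \<or> odd b \<and> b \<noteq> 1" "k = 0" | "b = 0 \<or> odd b \<and> b \<noteq> 1" "0 < k"
    | "even b" "b \<noteq> 0" | "b = 1" "k = 0" | "b = 1" "0 < k" by fastforce
  then show ?thesis
  proof cases
    case 1
    then have "odd b" "b \<noteq> 1" using i assms by auto
    then show ?thesis
      by (intro lex_less_twisted_start) (use y y' 1 in \<open>auto simp: twisted_block_def\<close>)
  next
    case 2
    then show ?thesis
      by (intro lex_less_twisted lex_less_overlap_pos[of k])
        (use y y' k in \<open>auto simp: twisted_block_def\<close>)
  next
    case 3
    then show ?thesis
      by (intro lex_less_twisted lex_less_neg[of k]) (use y k in \<open>auto simp: twisted_block_def\<close>)
  next
    case 4
    then have "lex_less m ?y a"
      by (intro lex_lessI[of 0]) (use y[of 0] m a M in \<open>auto simp: twisted_block_def\<close>)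
    then show ?thesis by (rule lex_less_twisted)
  next
    case 5
    \<comment> \<open>The increased last digit weakens the strict inequality inside the block to a non-strict one.\<close>
    have "lex_less (m - k) ?y a \<or> (\<forall>l<m - k. ?y l = a l)"
    proof -
      obtain j where j: "j < m - k" "\<And>l. l < j \<Longrightarrow> M - a (k + l) = a l" "M - a (k + j) < a j"
        using strict[OF k] by (rule lex_lessE) simp
      have yj: "?y l = a l" if "l < j" for l
        using that j y[of l] 5 by (simp add: twisted_block_def)
      have "?y j \<le> a j" using j y[of j] 5 by (simp add: twisted_block_def)
      moreover have "?y j < a j" if "Suc j < m - k"
        using j y[of j] 5 that by (simp add: twisted_block_def)
      ultimately consider "?y j < a j" | "?y j = a j" "Suc j = m - k" using j(1) by linarith
      then show ?thesis
      proof cases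
        case 1 then show ?thesis using lex_lessI[of j "m - k" ?y a] j(1) yj by blast
      next
        case 2 then show ?thesis using yj less_Suc_eq by metis
      qed
    qed
    then have "lex_less m ?y a"
      by (rule lex_less_overlap[OF 5(2) k]) (use y' k 5 in \<open>auto simp: twisted_block_def\<close>)
    then show ?thesis by (rule lex_less_twisted)
  qed
qed

lemma reflect_shift_twisted_lex_less:
  "\<exists>n. lex_less n (reflect M (shift i (twisted M a m))) (twisted M a m)"
proof -
  define b k where "b = i div m" and "k = i mod m"
  have i: "i = b * m + k" and k: "k < m" using m by (auto simp: b_def k_def)
  let ?y = "reflect M (shift i (twisted M a m))"
  have y: "?y l = M - twisted_block M a m b (k + l)" if "k + l < m" for l
    using shift_twisted[OF that, of b M a] i by simp
  have y': "?y (m - k + l) = M - twisted_block M a m (Suc b) l" if "l < m" for l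
    using shift_twisted_next[of k m l b M a] that k i by simp
  consider "b = 0 \<or> odd b \<and> b \<noteq> 1" | "even b" "b \<noteq> 0" "k = 0" | "even b" "b \<noteq> 0" "0 < k" | "b = 1"
    by fastforce
  then show ?thesis
  proof cases
    case 1
    then show ?thesis
      by (intro lex_less_twisted lex_less_neg[of k]) (use y k in \<open>auto simp: twisted_block_def\<close>)
  next
    case 2
    then show ?thesis
      by (intro lex_less_twisted_start) (use y y' 2 in \<open>auto simp: twisted_block_def\<close>)
  next
    case 3
    then show ?thesis
      by (intro lex_less_twisted lex_less_overlap_pos[of k])
        (use y y' k in \<open>auto simp: twisted_block_def\<close>)
  next
    case 4
    \<comment> \<open>The reflection of block \<open>1\<close> is \<open>p\<close> with its last digit decreased by one.\<close>
    have "lex_less (m - k) ?y (shift k a)"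
      by (rule lex_lessI[of "m - k - 1"])
        (use y[of "m - k - 1"] y k 4 in \<open>auto simp: twisted_block_def simp del: reflect_apply\<close>)
    then have "lex_less (m - k) ?y a" using le by (rule lex_less_le_trans)
    then have "lex_less m ?y a" by (rule lex_less_mono) simp
    then show ?thesis by (rule lex_less_twisted)
  qed
qed

end

section \<open>Approximation by univoque bases\<close>

lemma digit_value_base_mono:
  assumes "1 < p" "p \<le> q" "digits M x"
  shows "q / p * digit_value q x \<le> digit_value p x"
proof -
  have q1: "1 < q" using assms by simp
  have "q / p * (real_of_int (x i) / q ^ Suc i) \<le> real_of_int (x i) / p ^ Suc i" for i
  proof -
    have "p ^ i \<le> q ^ i" using assms by (intro power_mono) auto
    moreover have "0 \<le> real_of_int (x i) / p" using assms by (auto simp: digits_def)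
    ultimately have "real_of_int (x i) / p / q ^ i \<le> real_of_int (x i) / p / p ^ i"
      using assms by (intro divide_left_mono) auto
    then show ?thesis using q1 by (simp add: field_simps)
  qed
  then have "(\<Sum>i. q / p * (real_of_int (x i) / q ^ Suc i)) \<le> (\<Sum>i. real_of_int (x i) / p ^ Suc i)"
    using digits_summable[OF assms(1,3)] digits_summable[OF q1 assms(3)]
    by (intro suminf_le summable_mult)
  then show ?thesis
    unfolding digit_value_def using suminf_mult[OF digits_summable[OF q1 assms(3)], of "q / p"] by simp
qed

lemma digit_value_prefix:
  assumes "1 < q" "digits M x" "digits M y" "\<And>i. i < n \<Longrightarrow> x i = y i"
  shows "digit_value q x \<le> digit_value q y + real_of_int M / (q - 1) / q ^ n"
proof -
  have "digit_value q (shift n x) / q ^ n \<le> real_of_int M / (q - 1) / q ^ n"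
    using digit_value_le[OF assms(1) digits_shift[OF assms(2)]] assms(1) by (intro divide_right_mono) auto
  moreover have "0 \<le> digit_value q (shift n y) / q ^ n"
    using digit_value_nonneg[OF assms(1) digits_shift[OF assms(3)]] assms(1) by simp
  moreover have "(\<Sum>i<n. real_of_int (x i) / q ^ Suc i) = (\<Sum>i<n. real_of_int (y i) / q ^ Suc i)"
    using assms(4) by (intro sum.cong) auto
  ultimately show ?thesis
    using digit_value_split[OF assms(1,2), of n] digit_value_split[OF assms(1,3), of n] by linarith
qed

lemma isCont_digit_value:
  assumes "1 < q" "digits M x"
  shows "isCont (\<lambda>q. digit_value q x) q"
proof -
  define p where "p = (1 + q) / 2"
  have p: "1 < p" "p < q" using assms by (auto simp: p_def)
  let ?f = "\<lambda>z. \<Sum>i. real_of_int (x i) * z ^ i"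
  have "summable (\<lambda>i. p * (real_of_int (x i) / p ^ Suc i))"
    using digits_summable[OF p(1) assms(2)] by (rule summable_mult)
  then have sm: "summable (\<lambda>i. real_of_int (x i) * (1 / p) ^ i)"
    using p by (simp add: power_divide)
  have "norm (1 / q) < norm (1 / p)" using p by (simp add: divide_strict_left_mono)
  then have "isCont ?f (1 / q)" by (rule isCont_powser[OF sm])
  then have "isCont (\<lambda>q. ?f (1 / q)) q"
    by (intro isCont_o2[where f = "\<lambda>q. 1 / q" and g = ?f] continuous_intros) (use assms in auto)
  then have cont: "isCont (\<lambda>q. ?f (1 / q) / q) q"
    by (intro continuous_intros) (use assms in auto)
  \<comment> \<open>The value is a power series in the inverse of the base.\<close>
  have eq: "?f (1 / r) / r = digit_value r x" if "1 < r" for r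
  proof -
    have "summable (\<lambda>i. r * (real_of_int (x i) / r ^ Suc i))"
      using digits_summable[OF that assms(2)] by (rule summable_mult)
    then have "summable (\<lambda>i. real_of_int (x i) * (1 / r) ^ i)"
      using that by (simp add: power_divide)
    from suminf_divide[OF this, of r] show ?thesis
      unfolding digit_value_def by (simp add: power_divide mult.commute)
  qed
  have "eventually (\<lambda>r. 1 < r) (nhds q)"
    using assms(1) by (intro order_tendstoD(1)[OF filterlim_ident])
  then have "eventually (\<lambda>r. ?f (1 / r) / r = digit_value r x) (nhds q)"
    by (rule eventually_mono) (rule eq)
  from isCont_cong[OF this] cont show ?thesis by simp
qed

lemma unique_infinite_imp_closure:
  assumes q: "max_digit q M" and a: "digits M a" "digit_value q a = 1" "infinite_seq a"
    and uniq: "\<And>c. digits M c \<Longrightarrow> digit_value q c = 1 \<Longrightarrow> infinite_seq c \<Longrightarrow> c = a"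
  shows "q \<in> closure univoque_bases"
proof (cases "q = real_of_int M + 1")
  case True
  then have "q \<in> univoque_bases"
    unfolding univoque_iff[OF q] using integer_base_unique[OF q] by blast
  then show ?thesis using closure_subset by blast
next
  case False
  have q1: "1 < q" using q by (rule max_digit_gt_1)
  have qM: "real_of_int M < q" "q < real_of_int M + 1" "1 \<le> M"
    using q False by (auto simp: max_digit_def)
  note tails = unique_infinite_tails[OF q a uniq]
  note lex = lex_of_tails[OF q1 a tails(1,2)]
  show ?thesis
    unfolding closure_approachable
  proof (intro allI impI)
    fix e :: real assume e: "0 < e"
    \<comment> \<open>Bases on either side of \<open>q\<close>, within \<open>e\<close> of it and with the same largest digit \<open>M\<close>.\<close>
    define lo where "lo = max ((q + M) / 2) (q - e / 2)"
    define hi where "hi = min ((q + M + 1) / 2) (q + e / 2)"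
    have lo: "real_of_int M < lo" "lo < q" "q - e < lo" using qM e by (auto simp: lo_def less_max_iff_disj)
    have hi: "q < hi" "hi < real_of_int M + 1" "hi < q + e" using qM e by (auto simp: hi_def min_less_iff_disj)
    have lo1: "1 < lo" and hi1: "1 < hi" using lo hi qM q1 by linarith+
    have small: "\<exists>N. \<forall>n\<ge>N. real_of_int M / (r - 1) / r ^ n < \<epsilon>" if "1 < r" "0 < \<epsilon>" for r \<epsilon> :: real
    proof -
      have "(\<lambda>n. real_of_int M / (r - 1) * (1 / r) ^ n) \<longlonglongrightarrow> 0"
        by (intro tendsto_mult_right_zero LIMSEQ_power_zero) (use that in auto)
      from order_tendstoD(2)[OF this that(2)] show ?thesis
        by (simp add: eventually_sequentially power_divide)
    qed
    have "0 < q / lo - 1" "0 < 1 - q / hi" using lo hi lo1 hi1 by auto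
    then obtain N1 N2 where N1: "\<And>n. N1 \<le> n \<Longrightarrow> real_of_int M / (lo - 1) / lo ^ n < q / lo - 1"
      and N2: "\<And>n. N2 \<le> n \<Longrightarrow> real_of_int M / (hi - 1) / hi ^ n < 1 - q / hi"
      using small[OF lo1] small[OF hi1] by metis
    obtain m where m: "max 2 (max N1 N2) \<le> m"
      "\<And>i. i < m \<Longrightarrow> lex_less (m - i) (reflect M (shift i a)) a"
      using strict_prefix_exists[OF lex] by blast
    have m2: "2 \<le> m" using m(1) by simp
    let ?c = "twisted M a m"
    note hyps = lex(1) m(2) a(1) tails(3) qM(3) m2
    have c: "digits M ?c" by (rule digits_twisted[OF hyps])
    have "q / lo \<le> digit_value lo a"
      using digit_value_base_mono[OF lo1 _ a(1), of q] lo a(2) by simp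
    moreover have "digit_value lo a \<le> digit_value lo ?c + real_of_int M / (lo - 1) / lo ^ m"
      by (rule digit_value_prefix[OF lo1 a(1) c]) (simp add: twisted_prefix)
    ultimately have vlo: "1 \<le> digit_value lo ?c" using N1[of m] m(1) by linarith
    have "hi / q * digit_value hi a \<le> 1"
      using digit_value_base_mono[OF q1 _ a(1), of hi] hi a(2) by simp
    then have "digit_value hi a \<le> q / hi" using q1 hi1 by (simp add: field_simps)
    moreover have "digit_value hi ?c \<le> digit_value hi a + real_of_int M / (hi - 1) / hi ^ m"
      by (rule digit_value_prefix[OF hi1 c a(1)]) (simp add: twisted_prefix)
    ultimately have vhi: "digit_value hi ?c \<le> 1" using N2[of m] m(1) by linarith
    have "\<exists>r\<ge>lo. r \<le> hi \<and> digit_value r ?c = 1"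
      by (rule IVT2[where f = "\<lambda>r. digit_value r ?c", OF vhi vlo]) (use lo hi lo1 isCont_digit_value[OF _ c] in auto)
    then obtain r where r: "lo \<le> r" "r \<le> hi" "digit_value r ?c = 1" by blast
    have "max_digit r M" using r lo hi qM by (simp add: max_digit_def)
    then have "r \<in> univoque_bases"
      by (rule univoque_of_lex[OF _ c r(3) shift_twisted_lex_less[OF hyps]
            reflect_shift_twisted_lex_less[OF hyps]])
    moreover have "dist r q < e" using r lo hi by (simp add: dist_real_def)
    ultimately show "\<exists>y\<in>univoque_bases. dist y q < e" by blast
  qed
qed

theorem corollary5p4:
  fixes q :: real
  assumes "q > 1"
  shows "q \<in> closure univoque_bases \<longleftrightarrow> (\<exists>!c. expansion q 1 c \<and> infinite_seq c)"
proof -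
  obtain M where M: "max_digit q M" using max_digit_exists[OF assms] .
  show ?thesis
    unfolding expansion_iff[OF M]
  proof
    assume clos: "q \<in> closure univoque_bases"
    obtain c where c: "digits M c" "digit_value q c = 1" "infinite_seq c"
      using infinite_digits_exist[OF M zero_less_one max_digit_quotient_ge_1[OF M]] .
    then show "\<exists>!c. (digits M c \<and> digit_value q c = 1) \<and> infinite_seq c"
      using closure_imp_unique_infinite[OF M clos] by blast
  next
    assume "\<exists>!c. (digits M c \<and> digit_value q c = 1) \<and> infinite_seq c"
    then obtain a where "digits M a" "digit_value q a = 1" "infinite_seq a"
      "\<And>c. digits M c \<Longrightarrow> digit_value q c = 1 \<Longrightarrow> infinite_seq c \<Longrightarrow> c = a" by blast
    then show "q \<in> closure univoque_bases" by (rule unique_infinite_imp_closure[OF M])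
  qed
qed

end
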